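(* Let $\Delta$ be a convex union representable simplicial complex with vertex set $[n]$, $n\geq 1$. Then the Alexander dual $\Delta^*=\{\sigma\subseteq[n]\mid [n]\setminus\sigma\notin\Delta\}$ is collapsible.
   Context: A simplicial complex on a finite ground set is a collection $\Delta$ of subsets (faces) closed under inclusion. The void complex $\emptyset$ (no faces) is allowed and is distinct from the empty complex $\{\emptyset\}$. Facets are inclusion-maximal faces; vertices are one-element faces. (The Alexander dual is regarded as a complex on the ground set $[n]$; not every element of $[n]$ need be a vertex of $\Delta^*$.) The deletion is $\Delta\setminus\sigma=\{\tau\in\Delta\mid\tau\not\supseteq\sigma\}$. A face $\sigma$ that is not a facet is free if it is contained in a unique facet; then $\Delta\to\Delta\setminus\sigma$ is an elementary collapse. (The empty face may be used as a free face.) $\Delta$ collapses onto $\Gamma$ if there is a (possibly empty) finite sequence of elementary collapses starting with $\Delta$ and ending with $\Gamma$. $\Delta$ is collapsible if it collapses onto the void complex $\emptyset$ (in particular the void complex is collapsible). For a collection $\mathcal U=\{U_1,\dots,U_n\}$ of convex subsets of $\mathbb R^d$ (the empty set is convex, open and closed), put $U_\sigma=\bigcap_{i\in\sigma}U_i$ for $\emptyset\ne\sigma\subseteq[n]$ and $U_\emptyset=\operatorname{conv}(\bigcup_i U_i)$. The nerve is $\mathcal N(\mathcal U)=\{\sigma\subseteq[n]\mid U_\sigma\neq\emptyset\}$. A complex $\Delta\subseteq 2^{[n]}$ is $d$-convex union representable ($d\ge 0$ an integer) if $\Delta=\mathcal N(\mathcal U)$ for some collection $\mathcal U=\{U_i\}_{i=1}^n$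 of convex open sets in $\mathbb R^d$ whose union is convex. It is convex union representable if it is $d$-convex union representable for some $d$. *)

theory Defs
  imports "HOL-Analysis.Analysis" "HOL-Library.Function_Algebras"
begin

text \<open>
  The dimension \<open>d\<close> has to range over all natural numbers, zero included, inside a formula, so
  \<open>\<real>\<^sup>d\<close> is not a type here but the library's \<^const>\<open>Euclidean_space\<close>: the sequences
  \<open>x :: nat \<Rightarrow> real\<close> with \<open>x i = 0\<close> for \<open>i \<ge> d\<close>. The pointwise vector space structure on functions
  makes \<^const>\<open>convex\<close> and \<^const>\<open>hull\<close> available for sets of such sequences.
\<close>

instantiation "fun" :: (type, real_vector) real_vector
begin

definition scaleR_fun :: "real \<Rightarrow> ('a \<Rightarrow> 'b) \<Rightarrow> 'a \<Rightarrow> 'b"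
  where "scaleR_fun r f = (\<lambda>x. r *\<^sub>R f x)"

instance
  by standard (auto simp: scaleR_fun_def plus_fun_def fun_eq_iff scaleR_add_right scaleR_add_left)

end

definition abstract_simplicial_complex :: "'a set \<Rightarrow> 'a set set \<Rightarrow> bool"
  where "abstract_simplicial_complex V \<Delta> \<longleftrightarrow>
    finite V \<and> \<Delta> \<subseteq> Pow V \<and> (\<forall>\<sigma>\<in>\<Delta>. \<forall>\<tau>. \<tau> \<subseteq> \<sigma> \<longrightarrow> \<tau> \<in> \<Delta>)"

definition vertex_set :: "'a set set \<Rightarrow> 'a set"
  where "vertex_set \<Delta> = {v. {v} \<in> \<Delta>}"

definition facet :: "'a set set \<Rightarrow> 'a set \<Rightarrow> bool"
  where "facet \<Delta> \<sigma> \<longleftrightarrow> \<sigma> \<in> \<Delta> \<and> (\<forall>\<tau>\<in>\<Delta>. \<sigma> \<subseteq> \<tau> \<longrightarrow> \<tau> = \<sigma>)"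

definition deletion :: "'a set set \<Rightarrow> 'a set \<Rightarrow> 'a set set"
  where "deletion \<Delta> \<sigma> = {\<tau> \<in> \<Delta>. \<not> \<sigma> \<subseteq> \<tau>}"

definition free_face :: "'a set set \<Rightarrow> 'a set \<Rightarrow> bool"
  where "free_face \<Delta> \<sigma> \<longleftrightarrow> \<sigma> \<in> \<Delta> \<and> \<not> facet \<Delta> \<sigma> \<and> (\<exists>!\<tau>. facet \<Delta> \<tau> \<and> \<sigma> \<subseteq> \<tau>)"

definition elementary_collapse :: "'a set set \<Rightarrow> 'a set set \<Rightarrow> bool"
  where "elementary_collapse \<Delta> \<Gamma> \<longleftrightarrow> (\<exists>\<sigma>. free_face \<Delta> \<sigma> \<and> \<Gamma> = deletion \<Delta> \<sigma>)"

definition collapses_onto :: "'a set set \<Rightarrow> 'a set set \<Rightarrow> bool"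
  where "collapses_onto = elementary_collapse\<^sup>*\<^sup>*"

text \<open>The target is the void complex \<open>{}\<close>, not the empty complex \<open>{{}}\<close>.\<close>

definition collapsible :: "'a set set \<Rightarrow> bool"
  where "collapsible \<Delta> \<longleftrightarrow> collapses_onto \<Delta> {}"

definition alexander_dual :: "'a set \<Rightarrow> 'a set set \<Rightarrow> 'a set set"
  where "alexander_dual V \<Delta> = {\<sigma>. \<sigma> \<subseteq> V \<and> V - \<sigma> \<notin> \<Delta>}"

definition nerve_region :: "nat \<Rightarrow> (nat \<Rightarrow> 'b::real_vector set) \<Rightarrow> nat set \<Rightarrow> 'b set"
  where "nerve_region n U \<sigma> =
    (if \<sigma> = {} then convex hull (\<Union>i\<in>{1..n}. U i) else (\<Inter>i\<in>\<sigma>. U i))"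

definition nerve :: "nat \<Rightarrow> (nat \<Rightarrow> 'b::real_vector set) \<Rightarrow> nat set set"
  where "nerve n U = {\<sigma>. \<sigma> \<subseteq> {1..n} \<and> nerve_region n U \<sigma> \<noteq> {}}"

definition d_convex_union_representable :: "nat \<Rightarrow> nat \<Rightarrow> nat set set \<Rightarrow> bool"
  where "d_convex_union_representable d n \<Delta> \<longleftrightarrow>
    (\<exists>U :: nat \<Rightarrow> (nat \<Rightarrow> real) set.
      (\<forall>i\<in>{1..n}. convex (U i) \<and> openin (Euclidean_space d) (U i)) \<and>
      convex (\<Union>i\<in>{1..n}. U i) \<and>
      \<Delta> = nerve n U)"

definition convex_union_representable :: "nat \<Rightarrow> nat set set \<Rightarrow> bool"
  where "convex_union_representable n \<Delta> \<longleftrightarrow> (\<exists>d. d_convex_union_representable d n \<Delta>)"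

end

theory Submission
  imports Defs
begin

text \<open>
  Complementation turns a collapse that removes the interval \<open>[\<sigma>, \<tau>]\<close> into one that removes
  \<open>[V - \<tau>, V - \<sigma>]\<close>, and it swaps source and target. The dual of the full simplex is void, so the
  dual of \<open>\<Delta>\<close> is collapsible as soon as the full simplex collapses onto \<open>\<Delta>\<close>. The latter is what is
  proved, for the nerve of any closed convex cover of a compact convex set \<open>C\<close>
  (\<open>simplex_collapses_onto_trace_nerve\<close>); compactness serves to choose nearest points.

  The argument is an induction on the number of sets. Fix one of them, \<open>K v\<close>, and think of enlarging
  it to all of \<open>C\<close>. The nerve then becomes a cone with apex \<open>v\<close> over the nerve of the remaining sets,
  and the full simplex collapses onto every such cone by removing pairs \<open>(\<rho>, \<rho> \<union> {v})\<close>
  (\<open>cone_collapses_onto_subcone\<close>). To come back to the original nerve, the link of \<open>v\<close> has to be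
  collapsed from the nerve of the other sets on \<open>C\<close> onto their nerve on \<open>C \<inter> K v\<close>. The
  other sets cover \<open>C - K v\<close>, and \<open>trace_nerve_collapses_onto_if_simplices_collapse\<close> handles this
  situation: whenever \<open>C \<subseteq> W\<close> are compact convex sets and \<open>W - C\<close> is covered, the nerve on \<open>W\<close>
  collapses onto the nerve on \<open>C\<close>.

  For that, grow \<open>C\<close> towards \<open>W\<close> one point at a time. Let \<open>p\<close> be a point nearest to \<open>C\<close> at which
  some face absent from the nerve on \<open>C\<close> is realised, and let \<open>\<tau>\<close> be the set of all \<open>i\<close> with
  \<open>p \<in> K i\<close>. Passing to the hull of \<open>C\<close> and \<open>p\<close> adds exactly the faces of the simplex on \<open>\<tau>\<close>. A
  homothetic copy of \<open>C\<close>, shrunk sufficiently close to \<open>p\<close>, is covered by the sets indexed by \<open>\<tau>\<close>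
  alone and sees precisely those faces of that simplex that are already present on \<open>C\<close>. Since \<open>\<tau>\<close>
  does not contain the fixed vertex \<open>v\<close>, the induction hypothesis collapses the simplex on \<open>\<tau>\<close>
  onto these faces.

  Relatively open covers with convex union reduce to the compact case by the refinement
  \<open>compact_convex_refinement\<close>. The sequence space of all \<open>\<real>\<^sup>d\<close> carries no norm, so the sets are first
  transported to the normed space of bounded sequences.
\<close>

section \<open>Collapses of finite complexes\<close>

lemma elementary_collapseI:
  assumes "\<sigma> \<in> \<Delta>" "\<tau> \<in> \<Delta>" "\<sigma> \<subset> \<tau>" "\<And>\<rho>. \<rho> \<in> \<Delta> \<Longrightarrow> \<sigma> \<subseteq> \<rho> \<Longrightarrow> \<rho> \<subseteq> \<tau>"
  shows "elementary_collapse \<Delta> (deletion \<Delta> \<sigma>)"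
proof -
  have "\<rho> = \<tau>" if "\<rho> \<in> \<Delta>" "\<tau> \<subseteq> \<rho>" for \<rho>
    using assms(3) assms(4)[OF that(1)] that(2) by auto
  then have "facet \<Delta> \<tau>"
    using assms(2) by (simp add: facet_def)
  moreover have "\<rho> = \<tau>" if "facet \<Delta> \<rho>" "\<sigma> \<subseteq> \<rho>" for \<rho>
    using that(1) assms(2) assms(4)[OF _ that(2)] by (auto simp: facet_def)
  moreover have "\<not> facet \<Delta> \<sigma>"
    using assms(2,3) by (auto simp: facet_def)
  moreover have "\<sigma> \<subseteq> \<tau>"
    using assms(3) by blast
  ultimately have "free_face \<Delta> \<sigma>"
    using assms(1) unfolding free_face_def by blast
  then show ?thesis
    unfolding elementary_collapse_def by blast
qed

text \<open>
  In a finite complex every face lies in a facet, so a unique facet above \<open>\<sigma>\<close> is the greatest face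
  above \<open>\<sigma>\<close>. Stated without facets, freeness transfers between complexes by comparing
  faces only.
\<close>

lemma elementary_collapseE:
  assumes "elementary_collapse \<Delta> \<Gamma>" "finite \<Delta>"
  obtains \<sigma> \<tau> where "\<sigma> \<in> \<Delta>" "\<tau> \<in> \<Delta>" "\<sigma> \<subset> \<tau>" "\<And>\<rho>. \<rho> \<in> \<Delta> \<Longrightarrow> \<sigma> \<subseteq> \<rho> \<Longrightarrow> \<rho> \<subseteq> \<tau>"
    "\<Gamma> = deletion \<Delta> \<sigma>"
proof -
  obtain \<sigma> where \<sigma>: "free_face \<Delta> \<sigma>" "\<Gamma> = deletion \<Delta> \<sigma>"
    using assms(1) unfolding elementary_collapse_def by blast
  then have "\<exists>!\<tau>. facet \<Delta> \<tau> \<and> \<sigma> \<subseteq> \<tau>"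
    by (simp add: free_face_def)
  then obtain \<tau> where \<tau>: "facet \<Delta> \<tau>" "\<sigma> \<subseteq> \<tau>"
    and unique: "\<And>\<rho>. facet \<Delta> \<rho> \<Longrightarrow> \<sigma> \<subseteq> \<rho> \<Longrightarrow> \<rho> = \<tau>"
    by metis
  have below: "\<rho> \<subseteq> \<tau>" if "\<rho> \<in> \<Delta>" "\<sigma> \<subseteq> \<rho>" for \<rho>
  proof -
    have "\<exists>\<mu>\<in>\<Delta>. \<rho> \<subseteq> \<mu> \<and> (\<forall>\<nu>\<in>\<Delta>. \<mu> \<subseteq> \<nu> \<longrightarrow> \<mu> = \<nu>)"
      using assms(2) that(1) by (rule finite_has_maximal2)
    then obtain \<mu> where "\<mu> \<in> \<Delta>" "\<rho> \<subseteq> \<mu>" "\<forall>\<nu>\<in>\<Delta>. \<mu> \<subseteq> \<nu> \<longrightarrow> \<mu> = \<nu>"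
      by (elim bexE conjE)
    then have "facet \<Delta> \<mu>"
      by (auto simp: facet_def)
    then show ?thesis
      using unique[of \<mu>] \<open>\<rho> \<subseteq> \<mu>\<close> that(2) by simp
  qed
  have "\<sigma> \<noteq> \<tau>"
    using \<sigma>(1) \<tau>(1) by (metis free_face_def)
  moreover have "\<sigma> \<in> \<Delta>" "\<tau> \<in> \<Delta>"
    using \<sigma>(1) \<tau>(1) by (simp_all add: free_face_def facet_def)
  ultimately show thesis
    using \<sigma>(2) \<tau>(2) below by (intro that[of \<sigma> \<tau>]) auto
qed

lemma collapses_onto_refl: "collapses_onto \<Delta> \<Delta>"
  by (simp add: collapses_onto_def)

lemma collapses_onto_trans [trans]:
  "collapses_onto \<Delta> \<Gamma> \<Longrightarrow> collapses_onto \<Gamma> \<Theta> \<Longrightarrow> collapses_onto \<Delta> \<Theta>"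
  unfolding collapses_onto_def by (rule rtranclp_trans)

lemma elementary_collapse_subset: "elementary_collapse \<Delta> \<Gamma> \<Longrightarrow> \<Gamma> \<subseteq> \<Delta>"
  unfolding elementary_collapse_def deletion_def by auto

lemma collapses_onto_subset: "collapses_onto \<Delta> \<Gamma> \<Longrightarrow> \<Gamma> \<subseteq> \<Delta>"
  unfolding collapses_onto_def
  by (induction rule: rtranclp_induct) (use elementary_collapse_subset in blast)+

lemma collapses_onto_induct [consumes 2, case_names refl step]:
  assumes "collapses_onto \<Delta> \<Gamma>" "finite \<Delta>"
    and "P \<Gamma>"
    and "\<And>\<Delta> \<sigma> \<tau>. \<lbrakk>finite \<Delta>; \<sigma> \<in> \<Delta>; \<tau> \<in> \<Delta>; \<sigma> \<subset> \<tau>; \<And>\<rho>. \<rho> \<in> \<Delta> \<Longrightarrow> \<sigma> \<subseteq> \<rho> \<Longrightarrow> \<rho> \<subseteq> \<tau>;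
      \<Gamma> \<subseteq> deletion \<Delta> \<sigma>; P (deletion \<Delta> \<sigma>)\<rbrakk> \<Longrightarrow> P \<Delta>"
  shows "P \<Delta>"
  using assms(1,2) unfolding collapses_onto_def
proof (induction rule: converse_rtranclp_induct)
  case base
  show ?case by (rule assms(3))
next
  case (step \<Delta> \<Delta>')
  obtain \<sigma> \<tau> where st: "\<sigma> \<in> \<Delta>" "\<tau> \<in> \<Delta>" "\<sigma> \<subset> \<tau>" "\<And>\<rho>. \<rho> \<in> \<Delta> \<Longrightarrow> \<sigma> \<subseteq> \<rho> \<Longrightarrow> \<rho> \<subseteq> \<tau>"
    "\<Delta>' = deletion \<Delta> \<sigma>"
    using elementary_collapseE[OF step.hyps(1) step.prems] by metis
  have "\<Gamma> \<subseteq> deletion \<Delta> \<sigma>"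
    using step.hyps(2) st(5) collapses_onto_subset unfolding collapses_onto_def by blast
  moreover have "P (deletion \<Delta> \<sigma>)"
    using step.IH step.prems elementary_collapse_subset[OF step.hyps(1)] st(5)
    by (metis finite_subset)
  ultimately show ?case
    using assms(4) st(1-4) step.prems by blast
qed

text \<open>
  A free face of \<open>A\<close> stays free when faces are added that do not contain it.
\<close>

lemma collapses_onto_union:
  assumes "collapses_onto A B" "finite A"
    and "\<And>\<sigma> \<rho>. \<sigma> \<in> A - B \<Longrightarrow> \<rho> \<in> M \<Longrightarrow> \<not> \<sigma> \<subseteq> \<rho>"
  shows "collapses_onto (M \<union> A) (M \<union> B)"
  using assms
proof (induction rule: collapses_onto_induct)
  case refl
  show ?case by (rule collapses_onto_refl)
next
  case (step A \<sigma> \<tau>)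
  have "\<sigma> \<notin> B"
    using step.hyps(6) by (auto simp: deletion_def)
  then have avoid: "\<not> \<sigma> \<subseteq> \<rho>" if "\<rho> \<in> M" for \<rho>
    using step.prems step.hyps(2) that by blast
  have "elementary_collapse (M \<union> A) (deletion (M \<union> A) \<sigma>)"
    by (rule elementary_collapseI[of _ _ \<tau>]) (use step.hyps avoid in auto)
  moreover have "deletion (M \<union> A) \<sigma> = M \<union> deletion A \<sigma>"
    using avoid by (auto simp: deletion_def)
  moreover have "collapses_onto (M \<union> deletion A \<sigma>) (M \<union> B)"
    by (rule step.IH) (use step.prems in \<open>auto simp: deletion_def\<close>)
  ultimately show ?case
    by (simp add: collapses_onto_def converse_rtranclp_into_rtranclp)
qed

lemma collapses_onto_insert_image:
  assumes "collapses_onto A B" "finite A" "\<And>\<rho>. \<rho> \<in> A \<Longrightarrow> v \<notin> \<rho>"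
  shows "collapses_onto (insert v ` A) (insert v ` B)"
  using assms
proof (induction rule: collapses_onto_induct)
  case refl
  show ?case by (rule collapses_onto_refl)
next
  case (step A \<sigma> \<tau>)
  have iff: "insert v \<sigma> \<subseteq> insert v \<rho> \<longleftrightarrow> \<sigma> \<subseteq> \<rho>" if "\<rho> \<in> A" for \<rho>
    using that step.prems step.hyps(2) by blast
  have "v \<notin> \<sigma>" "v \<notin> \<tau>"
    using step.prems step.hyps by auto
  then have "elementary_collapse (insert v ` A) (deletion (insert v ` A) (insert v \<sigma>))"
    by (intro elementary_collapseI[of _ _ "insert v \<tau>"])
      (use step.hyps iff in blast)+
  moreover have "deletion (insert v ` A) (insert v \<sigma>) = insert v ` deletion A \<sigma>"
    using iff by (auto simp: deletion_def)
  moreover have "collapses_onto (insert v ` deletion A \<sigma>) (insert v ` B)"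
    by (rule step.IH) (use step.prems in \<open>auto simp: deletion_def\<close>)
  ultimately show ?case
    by (simp add: collapses_onto_def converse_rtranclp_into_rtranclp)
qed

text \<open>
  If \<open>\<rho>\<close> is maximal among the faces of \<open>\<Sigma>\<close> outside \<open>\<Gamma>\<close>, it is a facet of \<open>\<Sigma>\<close>, and the only face
  of the cone properly containing it is \<open>insert v \<rho>\<close>. The complex \<open>\<Gamma>\<close> may be void: the last
  collapse then removes the empty face together with the apex.
\<close>

lemma cone_collapses_onto_subcone:
  assumes "finite \<Sigma>" "\<Gamma> \<subseteq> \<Sigma>"
    and "\<And>\<sigma> \<rho>. \<sigma> \<in> \<Gamma> \<Longrightarrow> \<rho> \<subseteq> \<sigma> \<Longrightarrow> \<rho> \<in> \<Gamma>"
    and "\<And>\<rho>. \<rho> \<in> \<Sigma> \<Longrightarrow> v \<notin> \<rho>"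
  shows "collapses_onto (\<Sigma> \<union> insert v ` \<Sigma>) (\<Gamma> \<union> insert v ` \<Gamma>)"
  using assms
proof (induction "card (\<Sigma> - \<Gamma>)" arbitrary: \<Sigma> rule: less_induct)
  case less
  show ?case
  proof (cases "\<Sigma> = \<Gamma>")
    case True
    then show ?thesis by (simp add: collapses_onto_refl)
  next
    case False
    then have "\<exists>\<rho>\<in>\<Sigma> - \<Gamma>. \<forall>\<mu>\<in>\<Sigma> - \<Gamma>. \<rho> \<subseteq> \<mu> \<longrightarrow> \<rho> = \<mu>"
      using less.prems(1,2) by (intro finite_has_maximal) auto
    then obtain \<rho> where \<rho>: "\<rho> \<in> \<Sigma> - \<Gamma>" and "\<And>\<mu>. \<mu> \<in> \<Sigma> - \<Gamma> \<Longrightarrow> \<rho> \<subseteq> \<mu> \<Longrightarrow> \<mu> = \<rho>"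
      by blast
    then have maximal: "\<mu> = \<rho>" if "\<mu> \<in> \<Sigma>" "\<rho> \<subseteq> \<mu>" for \<mu>
      using that less.prems(3) by blast
    let ?\<Sigma> = "\<Sigma> \<union> insert v ` \<Sigma>" and ?\<Sigma>' = "(\<Sigma> - {\<rho>}) \<union> insert v ` (\<Sigma> - {\<rho>})"
    have v: "v \<notin> \<mu>" if "\<mu> \<in> \<Sigma>" for \<mu>
      using less.prems(4) that .
    have above: "\<rho> \<subseteq> insert v \<mu> \<longleftrightarrow> \<mu> = \<rho>" if "\<mu> \<in> \<Sigma>" for \<mu>
      using maximal[OF that] v \<rho> by blast
    have "\<rho> \<subset> insert v \<rho>"
      using v \<rho> by auto
    then have "elementary_collapse ?\<Sigma> (deletion ?\<Sigma> \<rho>)"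
      by (intro elementary_collapseI[of _ _ "insert v \<rho>"]) (use \<rho> above maximal in auto)
    moreover have "deletion ?\<Sigma> \<rho> = ?\<Sigma>'"
      using above maximal \<rho> by (auto simp: deletion_def)
    moreover have "collapses_onto ?\<Sigma>' (\<Gamma> \<union> insert v ` \<Gamma>)"
    proof (rule less.hyps)
      show "card (\<Sigma> - {\<rho>} - \<Gamma>) < card (\<Sigma> - \<Gamma>)"
        using \<rho> less.prems(1) by (intro psubset_card_mono) auto
    qed (use less.prems \<rho> in auto)
    ultimately show ?thesis
      by (simp add: collapses_onto_def converse_rtranclp_into_rtranclp)
  qed
qed

section \<open>Alexander duality reverses collapses\<close>

lemma alexander_dual_elementary_collapse:
  assumes "abstract_simplicial_complex V \<Delta>" "elementary_collapse \<Delta> \<Gamma>"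
  shows "elementary_collapse (alexander_dual V \<Gamma>) (alexander_dual V \<Delta>)"
proof -
  have fin: "finite \<Delta>" and sub: "\<Delta> \<subseteq> Pow V" and down: "\<And>\<sigma> \<rho>. \<sigma> \<in> \<Delta> \<Longrightarrow> \<rho> \<subseteq> \<sigma> \<Longrightarrow> \<rho> \<in> \<Delta>"
    using assms(1) finite_subset unfolding abstract_simplicial_complex_def by (auto intro: finite_subset)
  obtain \<sigma> \<tau> where st: "\<sigma> \<in> \<Delta>" "\<tau> \<in> \<Delta>" "\<sigma> \<subset> \<tau>" and below: "\<And>\<rho>. \<rho> \<in> \<Delta> \<Longrightarrow> \<sigma> \<subseteq> \<rho> \<Longrightarrow> \<rho> \<subseteq> \<tau>"
    and \<Gamma>: "\<Gamma> = deletion \<Delta> \<sigma>"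
    using elementary_collapseE[OF assms(2) fin] by metis
  have V: "V - (V - \<sigma>) = \<sigma>" "V - (V - \<tau>) = \<tau>"
    using st sub by auto
  have removed: "\<rho> \<in> \<Delta> - \<Gamma> \<longleftrightarrow> \<sigma> \<subseteq> \<rho> \<and> \<rho> \<subseteq> \<tau>" for \<rho>
    using below[of \<rho>] down[OF st(2), of \<rho>] unfolding \<Gamma> deletion_def by blast
  have "elementary_collapse (alexander_dual V \<Gamma>) (deletion (alexander_dual V \<Gamma>) (V - \<tau>))"
  proof (rule elementary_collapseI)
    show "V - \<sigma> \<in> alexander_dual V \<Gamma>" "V - \<tau> \<in> alexander_dual V \<Gamma>"
      using V st removed[of \<sigma>] removed[of \<tau>] by (simp_all add: alexander_dual_def)
    show "V - \<tau> \<subset> V - \<sigma>"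
      using st sub by auto
    fix \<rho> assume "\<rho> \<in> alexander_dual V \<Gamma>" "V - \<tau> \<subseteq> \<rho>"
    then have "\<rho> \<subseteq> V" "V - \<rho> \<in> \<Delta> - \<Gamma>"
      using down[OF st(2), of "V - \<rho>"] by (auto simp: alexander_dual_def)
    then show "\<rho> \<subseteq> V - \<sigma>"
      using removed[of "V - \<rho>"] by blast
  qed
  moreover have "deletion (alexander_dual V \<Gamma>) (V - \<tau>) = alexander_dual V \<Delta>"
  proof -
    have "V - \<rho> \<notin> \<Delta> \<longleftrightarrow> V - \<rho> \<notin> \<Gamma> \<and> \<not> V - \<tau> \<subseteq> \<rho>" if "\<rho> \<subseteq> V" for \<rho>
    proof -
      have "V - \<tau> \<subseteq> \<rho> \<longleftrightarrow> V - \<rho> \<subseteq> \<tau>"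
        using that by auto
      then show ?thesis
        using removed[of "V - \<rho>"] down[OF st(2), of "V - \<rho>"] \<Gamma> by (auto simp: deletion_def)
    qed
    then show ?thesis
      by (auto simp: deletion_def alexander_dual_def)
  qed
  ultimately show ?thesis by simp
qed

lemma alexander_dual_collapses_onto:
  assumes "collapses_onto \<Delta> \<Gamma>" "abstract_simplicial_complex V \<Delta>"
  shows "collapses_onto (alexander_dual V \<Gamma>) (alexander_dual V \<Delta>)"
  using assms unfolding collapses_onto_def
proof (induction rule: converse_rtranclp_induct)
  case base
  show ?case by simp
next
  case (step \<Delta> \<Delta>')
  obtain \<sigma> where "\<Delta>' = deletion \<Delta> \<sigma>"
    using step.hyps(1) unfolding elementary_collapse_def by auto
  then have "abstract_simplicial_complex V \<Delta>'"
    using step.prems by (fastforce simp: abstract_simplicial_complex_def deletion_def)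
  then show ?case
    using step.IH alexander_dual_elementary_collapse[OF step.prems step.hyps(1)]
    by (meson rtranclp.rtrancl_into_rtrancl)
qed

section \<open>Nerves of closed convex sets\<close>

text \<open>
  The nerve of the traces \<open>K i \<inter> C\<close>, where the empty face stands for \<open>C\<close> itself. Hence the nerve is
  void for empty \<open>C\<close>, and the link of a vertex \<open>v\<close> is again a trace nerve, on \<open>C \<inter> K v\<close>.
\<close>

definition trace_nerve :: "'i set \<Rightarrow> ('i \<Rightarrow> 'a set) \<Rightarrow> 'a set \<Rightarrow> 'i set set"
  where "trace_nerve I K C = {\<sigma>. \<sigma> \<subseteq> I \<and> C \<inter> (\<Inter>i\<in>\<sigma>. K i) \<noteq> {}}"

lemma trace_nerve_mono: "C \<subseteq> W \<Longrightarrow> trace_nerve I K C \<subseteq> trace_nerve I K W"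
  unfolding trace_nerve_def by blast

lemma trace_nerve_down: "\<sigma> \<in> trace_nerve I K C \<Longrightarrow> \<rho> \<subseteq> \<sigma> \<Longrightarrow> \<rho> \<in> trace_nerve I K C"
  unfolding trace_nerve_def by blast

lemma finite_trace_nerve: "finite I \<Longrightarrow> finite (trace_nerve I K C)"
  unfolding trace_nerve_def by (rule finite_subset[of _ "Pow I"]) auto

lemma trace_nerve_insert:
  assumes "v \<notin> I"
  shows "trace_nerve (insert v I) K C =
    trace_nerve I K C \<union> insert v ` trace_nerve I K (C \<inter> K v)"
proof (intro set_eqI iffI)
  fix \<sigma> assume \<sigma>: "\<sigma> \<in> trace_nerve (insert v I) K C"
  show "\<sigma> \<in> trace_nerve I K C \<union> insert v ` trace_nerve I K (C \<inter> K v)"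
  proof (cases "v \<in> \<sigma>")
    case True
    then have "\<sigma> = insert v (\<sigma> - {v})" "\<sigma> - {v} \<in> trace_nerve I K (C \<inter> K v)"
      using \<sigma> unfolding trace_nerve_def by auto
    then show ?thesis by blast
  qed (use \<sigma> in \<open>auto simp: trace_nerve_def\<close>)
qed (auto simp: trace_nerve_def)

text \<open>
  Moving from \<open>p\<close> towards any point of \<open>C\<close> decreases the distance to \<open>C\<close> strictly, so a nearest
  point \<open>p\<close> is the only point of \<open>Z\<close> seen by the hull.
\<close>

lemma exists_nearest_point:
  fixes C :: "'a::real_normed_vector set"
  assumes C: "convex C" "compact C" and Z: "compact Z" "Z \<noteq> {}" and disjoint: "C \<inter> Z = {}"
  obtains p where "p \<in> Z" "convex hull (insert p C) \<inter> Z = {p}"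
proof (cases "C = {}")
  case True
  then show thesis using that Z by auto
next
  case False
  have "compact (Z \<times> C)" "Z \<times> C \<noteq> {}"
    using C Z False by (auto intro: compact_Times)
  then obtain p q where pq: "p \<in> Z" "q \<in> C"
    and min: "\<And>z c. z \<in> Z \<Longrightarrow> c \<in> C \<Longrightarrow> dist p q \<le> dist z c"
  proof -
    have "continuous_on (Z \<times> C) (\<lambda>z. dist (fst z) (snd z))"
      by (intro continuous_intros)
    from continuous_attains_inf[OF \<open>compact (Z \<times> C)\<close> \<open>Z \<times> C \<noteq> {}\<close> this] show thesis
      using that by auto
  qed
  have pos: "dist p q > 0"
    using disjoint pq by auto
  have "x = p" if x: "x \<in> convex hull (insert p C)" "x \<in> Z" for x
  proof -
    obtain c u where u: "0 \<le> u" "u \<le> 1" "c \<in> C" and xeq: "x = (1 - u) *\<^sub>R p + u *\<^sub>R c"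
      using x(1) C(1) False by (auto simp: convex_hull_insert_alt hull_same)
    have "(1 - u) *\<^sub>R q + u *\<^sub>R c \<in> C"
      using C(1) pq u by (simp add: convexD_alt)
    then have "dist p q \<le> dist x ((1 - u) *\<^sub>R q + u *\<^sub>R c)"
      using min x(2) by blast
    also have "\<dots> = norm ((1 - u) *\<^sub>R (p - q))"
      by (simp add: xeq dist_norm algebra_simps)
    also have "\<dots> = (1 - u) * dist p q"
      using u by (simp add: dist_norm)
    finally have "u * dist p q \<le> 0"
      by (simp add: algebra_simps)
    then have "u = 0"
      using pos u by (simp add: mult_le_0_iff)
    then show "x = p"
      by (simp add: xeq)
  qed
  moreover have "p \<in> convex hull (insert p C)"
    by (simp add: hull_inc)
  ultimately show thesis
    using that pq(1) by blast
qed

text \<open>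
  Homothetic copies of a bounded set shrink uniformly to the centre \<open>p\<close>.
\<close>

lemma exists_contraction_avoiding_closed:
  fixes C :: "'a::real_normed_vector set"
  assumes "bounded C" "closed Z" "p \<notin> Z"
  obtains \<epsilon> :: real where "0 < \<epsilon>" "\<epsilon> < 1" "(\<lambda>c. (1 - \<epsilon>) *\<^sub>R p + \<epsilon> *\<^sub>R c) ` C \<inter> Z = {}"
proof -
  obtain r where r: "r > 0" "\<And>x. dist p x < r \<Longrightarrow> x \<notin> Z"
  proof -
    have "open (- Z)" "p \<in> - Z"
      using assms(2,3) by auto
    then obtain r where "r > 0" "ball p r \<subseteq> - Z"
      by (meson open_contains_ball)
    then show thesis
      using that by (auto simp: subset_iff)
  qed
  obtain B where B: "B > 0" "\<And>c. c \<in> C \<Longrightarrow> dist p c \<le> B"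
  proof -
    obtain B where "\<forall>c\<in>C. dist p c \<le> B"
      using assms(1) bounded_any_center[of C p] by blast
    then show thesis
      using that[of "max B 1"] by force
  qed
  \<comment> \<open>The factor 2 makes the estimate below strict, and the bound \<open>1/2\<close> keeps \<open>\<epsilon>\<close> below 1.\<close>
  define \<epsilon> where "\<epsilon> = min (1/2) (r / (2 * B))"
  show thesis
  proof
    show "0 < \<epsilon>" "\<epsilon> < 1"
      using r(1) B(1) by (auto simp: \<epsilon>_def)
    have "(1 - \<epsilon>) *\<^sub>R p + \<epsilon> *\<^sub>R c \<notin> Z" if "c \<in> C" for c
    proof -
      have "dist p ((1 - \<epsilon>) *\<^sub>R p + \<epsilon> *\<^sub>R c) = norm (\<epsilon> *\<^sub>R (p - c))"
        by (simp add: dist_norm algebra_simps)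
      also have "\<dots> = \<epsilon> * dist p c"
        using \<open>0 < \<epsilon>\<close> by (simp add: dist_norm)
      also have "\<dots> \<le> (r / (2 * B)) * B"
        using B(2)[OF that] B(1) r(1) by (intro mult_mono) (auto simp: \<epsilon>_def)
      also have "\<dots> < r"
        using B(1) r(1) by simp
      finally show ?thesis
        using r(2) by blast
    qed
    then show "(\<lambda>c. (1 - \<epsilon>) *\<^sub>R p + \<epsilon> *\<^sub>R c) ` C \<inter> Z = {}"
      by blast
  qed
qed

text \<open>
  The induction counts the faces still to be removed. Each round inserts between \<open>C\<close> and \<open>W\<close> the
  hull \<open>C'\<close> of \<open>C\<close> and a nearest point \<open>p\<close>: the collapse onto the nerve on \<open>C'\<close> is the induction
  hypothesis, and the collapse from there to \<open>C\<close> takes place inside the simplex on the sets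
  containing \<open>p\<close>. Only \<open>W - C\<close> is assumed to be covered, which suffices because the shrunken copy of
  \<open>C\<close> avoids \<open>C\<close>; this is what allows one set of a cover to be enlarged.
\<close>

lemma trace_nerve_collapses_onto_if_simplices_collapse:
  fixes K :: "'i \<Rightarrow> 'a::real_normed_vector set"
  assumes simplex: "\<And>\<tau> C. \<lbrakk>\<tau> \<subseteq> I; \<tau> \<noteq> {}; convex C; compact C; C \<subseteq> (\<Union>i\<in>\<tau>. K i)\<rbrakk>
      \<Longrightarrow> collapses_onto (Pow \<tau>) (trace_nerve \<tau> K C)"
    and I: "finite I" and K: "\<And>i. i \<in> I \<Longrightarrow> convex (K i)" "\<And>i. i \<in> I \<Longrightarrow> closed (K i)"
    and W: "convex W" "compact W"
    and C: "convex C" "compact C" "C \<subseteq> W" and cover: "W - C \<subseteq> (\<Union>i\<in>I. K i)"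
  shows "collapses_onto (trace_nerve I K W) (trace_nerve I K C)"
  using C cover
proof (induction "card (trace_nerve I K W - trace_nerve I K C)" arbitrary: C rule: less_induct)
  case less
  let ?N = "trace_nerve I K"
  note C = less.prems(1-3) and cover = less.prems(4)
  show ?case
  proof (cases "?N W = ?N C")
    case True
    then show ?thesis by (simp add: collapses_onto_refl)
  next
    case False
    define D where "D = ?N W - ?N C"
    \<comment> \<open>\<open>Z\<close> collects all points of \<open>W\<close> realising a face that has to disappear.\<close>
    define Z where "Z = (\<Union>\<sigma>\<in>D. W \<inter> (\<Inter>i\<in>\<sigma>. K i))"
    have finN: "finite (?N A)" for A
      using I by (rule finite_trace_nerve)
    have "D \<noteq> {}"
      using False trace_nerve_mono[OF C(3)] unfolding D_def by blast
    have D_sub: "\<sigma> \<subseteq> I" if "\<sigma> \<in> D" for \<sigma>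
      using that unfolding D_def trace_nerve_def by auto
    have "compact Z"
      unfolding Z_def
    proof (intro compact_UN ballI compact_Int_closed W closed_INT)
      show "finite D" unfolding D_def using finN by blast
    qed (use K D_sub in blast)
    moreover have "Z \<noteq> {}"
      using \<open>D \<noteq> {}\<close> unfolding Z_def D_def trace_nerve_def by blast
    moreover have "C \<inter> Z = {}"
      unfolding Z_def D_def trace_nerve_def by blast
    ultimately obtain p where p: "p \<in> Z" and nearest: "convex hull (insert p C) \<inter> Z = {p}"
      using exists_nearest_point[OF C(1,2)] by blast
    have pW: "p \<in> W" and pC: "p \<notin> C"
      using p \<open>C \<inter> Z = {}\<close> unfolding Z_def by auto
    define C' where "C' = convex hull (insert p C)"
    have C': "convex C'" "compact C'" "C \<subseteq> C'" "C' \<subseteq> W" "p \<in> C'"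
    proof -
      show "convex C'" "C \<subseteq> C'" "p \<in> C'"
        unfolding C'_def using hull_subset[of "insert p C" convex] by auto
      show "C' \<subseteq> W"
        unfolding C'_def using W(1) C(3) pW by (intro hull_minimal) auto
      show "compact C'"
        using compact_convex_combinations[of "{p}" C] C
        by (simp add: C'_def convex_hull_insert_alt hull_same) 
    qed
    \<comment> \<open>A face that is new on \<open>C'\<close> can be realised there only at \<open>p\<close>.\<close>
    have meets: "p \<in> (\<Inter>i\<in>\<sigma>. K i)" if "\<sigma> \<in> D" "x \<in> C'" "x \<in> (\<Inter>i\<in>\<sigma>. K i)" for \<sigma> x
    proof -
      have "x \<in> Z"
        using that C'(4) unfolding Z_def by blast
      then show ?thesis
        using nearest that unfolding C'_def by blast
    qed
    define \<tau> where "\<tau> = {i\<in>I. p \<in> K i}"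
    have \<tau>: "\<tau> \<subseteq> I" "\<tau> \<noteq> {}"
      using cover pW pC unfolding \<tau>_def by auto
    have p\<tau>: "p \<in> (\<Inter>i\<in>\<sigma>. K i)" if "\<sigma> \<subseteq> \<tau>" for \<sigma>
      using that unfolding \<tau>_def by auto
    obtain \<epsilon> :: real where \<epsilon>: "0 < \<epsilon>" "\<epsilon> < 1"
      and avoid: "(\<lambda>c. (1 - \<epsilon>) *\<^sub>R p + \<epsilon> *\<^sub>R c) ` C \<inter> (C \<union> (\<Union>i\<in>I - \<tau>. K i)) = {}"
    proof (rule exists_contraction_avoiding_closed)
      show "bounded C" using C by (simp add: compact_imp_bounded)
      show "closed (C \<union> (\<Union>i\<in>I - \<tau>. K i))"
        using C I K by (intro closed_Un closed_UN) (auto simp: compact_imp_closed)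
      show "p \<notin> C \<union> (\<Union>i\<in>I - \<tau>. K i)"
        using pC unfolding \<tau>_def by auto
    qed
    \<comment> \<open>The copy of \<open>C\<close> near \<open>p\<close> to which the hypothesis on simplices is applied.\<close>
    define S where "S = (\<lambda>c. (1 - \<epsilon>) *\<^sub>R p + \<epsilon> *\<^sub>R c) ` C"
    have "convex S"
      unfolding S_def using convex_affinity[OF C(1), of "(1 - \<epsilon>) *\<^sub>R p" \<epsilon>] by simp
    have "compact S"
      unfolding S_def by (intro compact_continuous_image C continuous_intros)
    have SC': "S \<subseteq> C'"
    proof -
      have "(1 - \<epsilon>) *\<^sub>R p + \<epsilon> *\<^sub>R c \<in> C'" if "c \<in> C" for c
        using convexD_alt[OF C'(1,5), of c \<epsilon>] that C'(3) \<epsilon> by auto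
      then show ?thesis
        unfolding S_def by blast
    qed
    have "S \<subseteq> (\<Union>i\<in>\<tau>. K i)"
    proof
      fix x assume x: "x \<in> S"
      then have "x \<notin> C" "x \<notin> (\<Union>i\<in>I - \<tau>. K i)"
        using avoid unfolding S_def by auto
      moreover have "x \<in> W"
        using x SC' C'(4) by blast
      ultimately show "x \<in> (\<Union>i\<in>\<tau>. K i)"
        using cover by blast
    qed
    have nerve_S: "trace_nerve \<tau> K S = Pow \<tau> \<inter> ?N C"
    proof (intro set_eqI iffI)
      fix \<sigma> assume "\<sigma> \<in> trace_nerve \<tau> K S"
      then obtain x where \<sigma>: "\<sigma> \<subseteq> \<tau>" and x: "x \<in> S" "x \<in> (\<Inter>i\<in>\<sigma>. K i)"
        unfolding trace_nerve_def by blast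
      have "x \<in> W" "x \<in> C'"
        using x SC' C'(4) by auto
      have "\<sigma> \<in> ?N C"
      proof (rule ccontr)
        assume "\<sigma> \<notin> ?N C"
        then have "\<sigma> \<in> D"
          using \<sigma> \<tau>(1) x(2) \<open>x \<in> W\<close> unfolding D_def trace_nerve_def by auto
        then have "x = p"
          using x(2) \<open>x \<in> W\<close> \<open>x \<in> C'\<close> nearest unfolding C'_def Z_def by blast
        then obtain c where "c \<in> C" "p = (1 - \<epsilon>) *\<^sub>R p + \<epsilon> *\<^sub>R c"
          using x(1) unfolding S_def by blast
        then have "\<epsilon> = 0 \<or> c = p"
          by (auto simp: algebra_simps)
        then show False
          using \<epsilon> \<open>c \<in> C\<close> pC by auto
      qed
      with \<sigma> show "\<sigma> \<in> Pow \<tau> \<inter> ?N C" by simp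
    next
      fix \<sigma> assume "\<sigma> \<in> Pow \<tau> \<inter> ?N C"
      then obtain c where \<sigma>: "\<sigma> \<subseteq> \<tau>" and c: "c \<in> C" "c \<in> (\<Inter>i\<in>\<sigma>. K i)"
        unfolding trace_nerve_def by blast
      have "convex (\<Inter>i\<in>\<sigma>. K i)"
        using \<sigma> \<tau>(1) K(1) by (intro convex_INT) auto
      then have "(1 - \<epsilon>) *\<^sub>R p + \<epsilon> *\<^sub>R c \<in> (\<Inter>i\<in>\<sigma>. K i)"
        using \<epsilon> c(2) p\<tau>[OF \<sigma>] by (intro convexD_alt) auto
      then show "\<sigma> \<in> trace_nerve \<tau> K S"
        using \<sigma> c(1) unfolding trace_nerve_def S_def by blast
    qed
    have nerve_C': "?N C' = ?N C \<union> Pow \<tau>"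
    proof
      show "?N C' \<subseteq> ?N C \<union> Pow \<tau>"
      proof
        fix \<sigma> assume \<sigma>: "\<sigma> \<in> ?N C'"
        then obtain x where x: "\<sigma> \<subseteq> I" "x \<in> C'" "x \<in> (\<Inter>i\<in>\<sigma>. K i)"
          unfolding trace_nerve_def by blast
        show "\<sigma> \<in> ?N C \<union> Pow \<tau>"
        proof (cases "\<sigma> \<in> ?N C")
          case False
          then have "\<sigma> \<in> D"
            using \<sigma> trace_nerve_mono[OF C'(4)] unfolding D_def by blast
          then show ?thesis
            using meets[OF _ x(2,3)] x(1) unfolding \<tau>_def by auto
        qed simp
      qed
      show "?N C \<union> Pow \<tau> \<subseteq> ?N C'"
      proof -
        have "Pow \<tau> \<subseteq> ?N C'"
          using p\<tau> \<tau>(1) C'(5) unfolding trace_nerve_def by blast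
        then show ?thesis
          using trace_nerve_mono[OF C'(3)] by blast
      qed
    qed
    obtain \<sigma> where "\<sigma> \<in> D" "p \<in> (\<Inter>i\<in>\<sigma>. K i)"
      using p unfolding Z_def by blast
    then have "\<sigma> \<in> ?N C'"
      using D_sub C'(5) unfolding trace_nerve_def by blast
    have "collapses_onto (?N W) (?N C')"
    proof (rule less.hyps)
      have "?N W - ?N C' \<subset> ?N W - ?N C"
        using \<open>\<sigma> \<in> D\<close> \<open>\<sigma> \<in> ?N C'\<close> trace_nerve_mono[OF C'(3)] unfolding D_def by blast
      then show "card (?N W - ?N C') < card (?N W - ?N C)"
        using finN by (intro psubset_card_mono) auto
      show "W - C' \<subseteq> (\<Union>i\<in>I. K i)"
        using cover C'(3) by blast
    qed (use C' in auto)
    also have "collapses_onto (?N C') (?N C)"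
    proof -
      have "collapses_onto (?N C \<union> Pow \<tau>) (?N C \<union> Pow \<tau> \<inter> ?N C)"
      proof (rule collapses_onto_union)
        show "collapses_onto (Pow \<tau>) (Pow \<tau> \<inter> ?N C)"
          using simplex[OF \<tau> \<open>convex S\<close> \<open>compact S\<close> \<open>S \<subseteq> (\<Union>i\<in>\<tau>. K i)\<close>] nerve_S by simp
        show "finite (Pow \<tau>)"
          using \<tau>(1) I finite_subset by auto
        show "\<not> \<sigma> \<subseteq> \<rho>" if "\<sigma> \<in> Pow \<tau> - Pow \<tau> \<inter> ?N C" "\<rho> \<in> ?N C" for \<sigma> \<rho>
          using that trace_nerve_down by blast
      qed
      then show ?thesis
        using nerve_C' by (simp add: Un_absorb2)
    qed
    finally show ?thesis .
  qed
qed

theorem simplex_collapses_onto_trace_nerve: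
  fixes K :: "'i \<Rightarrow> 'a::real_normed_vector set"
  assumes "finite I" "I \<noteq> {}" "\<And>i. i \<in> I \<Longrightarrow> convex (K i)" "\<And>i. i \<in> I \<Longrightarrow> closed (K i)"
    and "convex C" "compact C" "C \<subseteq> (\<Union>i\<in>I. K i)"
  shows "collapses_onto (Pow I) (trace_nerve I K C)"
  using assms
proof (induction "card I" arbitrary: I C rule: less_induct)
  case less
  obtain v where "v \<in> I"
    using less.prems(2) by blast
  define J where "J = I - {v}"
  have J: "finite J" "v \<notin> J" "I = insert v J" "J \<subseteq> I"
    using \<open>v \<in> I\<close> less.prems(1) unfolding J_def by auto
  let ?N = "trace_nerve J K"
  have "collapses_onto (?N C) (?N (C \<inter> K v))"
  proof (rule trace_nerve_collapses_onto_if_simplices_collapse)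
    show "collapses_onto (Pow \<tau>) (trace_nerve \<tau> K C)"
      if \<tau>: "\<tau> \<subseteq> J" "\<tau> \<noteq> {}" and C: "convex C" "compact C" "C \<subseteq> (\<Union>i\<in>\<tau>. K i)" for \<tau> C
    proof (rule less.hyps)
      show "card \<tau> < card I"
        using \<tau>(1) J less.prems(1) by (intro psubset_card_mono) auto
      show "finite \<tau>" 
        using \<tau>(1) J(1) by (rule finite_subset)
    qed (use \<tau> J C less.prems in auto)
    show "convex (C \<inter> K v)"
      using less.prems J by (intro convex_Int) auto
    show "compact (C \<inter> K v)"
      using less.prems J by (intro compact_Int_closed) auto
  qed (use less.prems J in auto)
  then have "collapses_onto (insert v ` ?N C) (insert v ` ?N (C \<inter> K v))"
    by (rule collapses_onto_insert_image) (use J finite_trace_nerve in \<open>auto simp: trace_nerve_def\<close>)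
  then have link: "collapses_onto (?N C \<union> insert v ` ?N C) (?N C \<union> insert v ` ?N (C \<inter> K v))"
    by (rule collapses_onto_union) (use J finite_trace_nerve in \<open>auto simp: trace_nerve_def\<close>)
  have "Pow I = Pow J \<union> insert v ` Pow J"
    unfolding J(3) by (rule Pow_insert)
  moreover have "collapses_onto (Pow J \<union> insert v ` Pow J) (?N C \<union> insert v ` ?N C)"
  proof (rule cone_collapses_onto_subcone)
    show "\<rho> \<in> ?N C" if "\<sigma> \<in> ?N C" "\<rho> \<subseteq> \<sigma>" for \<sigma> \<rho>
      using that by (rule trace_nerve_down)
  qed (use J in \<open>auto simp: trace_nerve_def\<close>)
  ultimately show ?case
    using link trace_nerve_insert[OF J(2)] J(3) by (metis collapses_onto_trans)
qed

section \<open>From relatively open to compact convex sets\<close>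

text \<open>
  The hull of two convex sets is the union of the segments joining them, hence a continuous image
  of a compact product. This needs no bound on the dimension, unlike compactness of the hull of an
  arbitrary compact set.
\<close>

lemma compact_convex_hull_Un:
  fixes S T :: "'a::real_normed_vector set"
  assumes "convex S" "compact S" "convex T" "compact T"
  shows "compact (convex hull (S \<union> T))"
proof (cases "S = {} \<or> T = {}")
  case True
  then show ?thesis
    using assms by (auto simp: hull_same)
next
  case False
  let ?J = "{(1 - u) *\<^sub>R x + u *\<^sub>R y |x y u. 0 \<le> u \<and> u \<le> 1 \<and> x \<in> S \<and> y \<in> T}"
  let ?A = "\<lambda>b. if b then T else S"
  have hull: "convex hull (S \<union> T) = convex hull (\<Union>(?A ` UNIV))"
    by (simp add: UNIV_bool Un_commute)
  have "convex hull (\<Union>(?A ` UNIV)) =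
      {sum (\<lambda>b. c b *\<^sub>R s b) UNIV |c s. (\<forall>b\<in>UNIV. c b \<ge> 0) \<and> sum c UNIV = 1 \<and> (\<forall>b\<in>UNIV. s b \<in> ?A b)}"
    using False assms by (intro convex_hull_finite_union) auto
  also have "\<dots> = ?J"
  proof (intro set_eqI iffI)
    fix z assume "z \<in> {sum (\<lambda>b. c b *\<^sub>R s b) UNIV |c s.
      (\<forall>b\<in>UNIV. c b \<ge> 0) \<and> sum c UNIV = 1 \<and> (\<forall>b\<in>UNIV. s b \<in> ?A b)}"
    then obtain c s where cs: "z = c False *\<^sub>R s False + c True *\<^sub>R s True" "c True \<ge> 0" "c False \<ge> 0"
      "c False + c True = 1" "s False \<in> S" "s True \<in> T"
      by (auto simp: UNIV_bool all_bool_eq)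
    then have "c False = 1 - c True"
      by simp
    then show "z \<in> ?J"
      using cs by (intro CollectI exI[of _ "s False"] exI[of _ "s True"] exI[of _ "c True"]) auto
  next
    fix z assume "z \<in> ?J"
    then obtain x y u where "z = (1 - u) *\<^sub>R x + u *\<^sub>R y" "0 \<le> u" "u \<le> 1" "x \<in> S" "y \<in> T"
      by blast
    then show "z \<in> {sum (\<lambda>b. c b *\<^sub>R s b) UNIV |c s.
      (\<forall>b\<in>UNIV. c b \<ge> 0) \<and> sum c UNIV = 1 \<and> (\<forall>b\<in>UNIV. s b \<in> ?A b)}"
      by (intro CollectI exI[of _ "\<lambda>b. if b then u else 1 - u"] exI[of _ "\<lambda>b. if b then y else x"])
        (auto simp: UNIV_bool)
  qed
  finally show ?thesis
    using hull compact_convex_combinations[OF assms(2,4)] by simp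
qed

lemma compact_convex_hull_finite_UN:
  fixes S :: "'i \<Rightarrow> 'a::real_normed_vector set"
  assumes "finite A" "\<And>a. a \<in> A \<Longrightarrow> convex (S a)" "\<And>a. a \<in> A \<Longrightarrow> compact (S a)"
  shows "compact (convex hull (\<Union>a\<in>A. S a))"
  using assms
proof (induction rule: finite_induct)
  case empty
  show ?case by simp
next
  case (insert a A)
  have "compact (convex hull (S a \<union> convex hull (\<Union>a\<in>A. S a)))"
    using insert by (intro compact_convex_hull_Un convex_convex_hull) auto
  then show ?case
    by (simp flip: hull_Un_right)
qed

text \<open>
  Choose a witness for every face of the nerve and let \<open>C\<close> be the hull of the witnesses. Finitely
  many closed balls, each of whose traces on \<open>C\<close> lies in a single \<open>U i\<close>, cover \<open>C\<close>; the hull of those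
  assigned to \<open>i\<close> and of the witnesses in \<open>U i\<close> is the required compact set inside \<open>U i\<close>. The balls
  secure the cover, the witnesses secure the faces.
\<close>

lemma compact_convex_refinement:
  fixes U :: "'i \<Rightarrow> 'a::real_normed_vector set"
  assumes I: "finite I" and X: "convex X" "X = (\<Union>i\<in>I. U i)"
    and U: "\<And>i. i \<in> I \<Longrightarrow> convex (U i)" "\<And>i. i \<in> I \<Longrightarrow> openin (top_of_set X) (U i)"
  obtains C :: "'a set" and K :: "'i \<Rightarrow> 'a set"
  where "convex C" "compact C" "C \<subseteq> (\<Union>i\<in>I. K i)"
    "\<And>i. i \<in> I \<Longrightarrow> convex (K i)" "\<And>i. i \<in> I \<Longrightarrow> compact (K i)"
    "trace_nerve I K C = trace_nerve I U X"
proof -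
  let ?N = "trace_nerve I U X"
  have "\<forall>\<sigma>\<in>?N. \<exists>x. x \<in> X \<inter> (\<Inter>i\<in>\<sigma>. U i)"
    unfolding trace_nerve_def by blast
  then obtain w where w: "\<And>\<sigma>. \<sigma> \<in> ?N \<Longrightarrow> w \<sigma> \<in> X \<inter> (\<Inter>i\<in>\<sigma>. U i)"
    by metis
  define P where "P = w ` ?N"
  have P: "finite P" "P \<subseteq> X"
    using w unfolding P_def by (auto intro: finite_trace_nerve I)
  define C where "C = convex hull P"
  have C: "convex C" "compact C" "C \<subseteq> X" "P \<subseteq> C"
    using P X(1) by (auto simp: C_def finite_imp_compact_convex_hull hull_minimal hull_inc
        subset_hull)
  have "\<exists>i e. i \<in> I \<and> e > 0 \<and> cball x e \<inter> C \<subseteq> U i" if x: "x \<in> C" for x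
  proof -
    obtain i where i: "i \<in> I" "x \<in> U i"
      using x C(3) X(2) by blast
    obtain e where e: "e > 0" "cball x e \<inter> X \<subseteq> U i"
      using U(2)[OF i(1)] i(2) unfolding openin_contains_cball by blast
    show ?thesis
      using i(1) e C(3) by blast
  qed
  then obtain ix e where ix: "\<And>x. x \<in> C \<Longrightarrow> ix x \<in> I" and e: "\<And>x. x \<in> C \<Longrightarrow> e x > 0"
    and cb: "\<And>x. x \<in> C \<Longrightarrow> cball x (e x) \<inter> C \<subseteq> U (ix x)"
    by metis
  have "C \<subseteq> (\<Union>x\<in>C. ball x (e x))"
    using e by force
  then obtain F where F: "F \<subseteq> C" "finite F" "C \<subseteq> (\<Union>x\<in>F. ball x (e x))"
    using compactE_image[OF C(2), of C "\<lambda>x. ball x (e x)"] by auto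
  define B where "B i = (\<Union>x\<in>{x\<in>F. ix x = i}. cball x (e x) \<inter> C)" for i
  define K where "K i = convex hull (convex hull (B i) \<union> convex hull (P \<inter> U i))" for i
  have KU: "K i \<subseteq> U i" if "i \<in> I" for i
  proof -
    have "B i \<subseteq> U i"
      using cb F(1) unfolding B_def by blast
    then show ?thesis
      unfolding K_def using U(1)[OF that] by (simp add: subset_hull)
  qed
  have BK: "B i \<subseteq> K i" and PK: "P \<inter> U i \<subseteq> K i" for i
    unfolding K_def by (meson Un_upper1 Un_upper2 hull_subset order_trans)+
  show thesis
  proof (rule that[of C K])
    show "compact (K i)" if "i \<in> I" for i
      unfolding K_def
    proof (intro compact_convex_hull_Un convex_convex_hull)
      show "compact (convex hull (B i))"
        unfolding B_def using F(2) C(1,2)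
        by (intro compact_convex_hull_finite_UN convex_Int convex_cball closed_Int_compact) auto
      show "compact (convex hull (P \<inter> U i))"
        using P(1) by (intro finite_imp_compact_convex_hull) auto
    qed
    show "C \<subseteq> (\<Union>i\<in>I. K i)"
    proof
      fix y assume y: "y \<in> C"
      then obtain x where x: "x \<in> F" "y \<in> ball x (e x)"
        using F(3) by blast
      then have "y \<in> B (ix x)"
        using y unfolding B_def by (auto intro!: exI[of _ x])
      then show "y \<in> (\<Union>i\<in>I. K i)"
        using BK ix x(1) F(1) by blast
    qed
    show "trace_nerve I K C = ?N"
    proof (intro set_eqI iffI)
      fix \<sigma> assume "\<sigma> \<in> trace_nerve I K C"
      then obtain x where x: "\<sigma> \<subseteq> I" "x \<in> C" "\<And>i. i \<in> \<sigma> \<Longrightarrow> x \<in> K i"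
        unfolding trace_nerve_def by blast
      then have "x \<in> X \<inter> (\<Inter>i\<in>\<sigma>. U i)"
        using KU C(3) by blast
      then show "\<sigma> \<in> ?N"
        using x(1) unfolding trace_nerve_def by blast
    next
      fix \<sigma> assume \<sigma>: "\<sigma> \<in> ?N"
      then have "w \<sigma> \<in> C \<inter> (\<Inter>i\<in>\<sigma>. K i)"
        using w[OF \<sigma>] PK C(4) unfolding P_def by blast
      then show "\<sigma> \<in> trace_nerve I K C"
        using \<sigma> unfolding trace_nerve_def by blast
    qed
  qed (auto simp: C K_def)
qed

section \<open>Sequence space inside a normed space\<close>

lemma convex_vimage_apply_bcontfun:
  fixes S :: "(nat \<Rightarrow> real) set"
  assumes "convex S"
  shows "convex (apply_bcontfun -` S :: (nat \<Rightarrow>\<^sub>C real) set)"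
proof (rule convexI)
  fix x y :: "nat \<Rightarrow>\<^sub>C real" and u v :: real
  assume "x \<in> apply_bcontfun -` S" "y \<in> apply_bcontfun -` S" "0 \<le> u" "0 \<le> v" "u + v = 1"
  then have "u *\<^sub>R apply_bcontfun x + v *\<^sub>R apply_bcontfun y \<in> S"
    using assms by (intro convexD) auto
  moreover have "u *\<^sub>R apply_bcontfun x + v *\<^sub>R apply_bcontfun y = apply_bcontfun (u *\<^sub>R x + v *\<^sub>R y)"
    by (simp add: fun_eq_iff scaleR_fun_def plus_bcontfun.rep_eq scaleR_bcontfun.rep_eq)
  ultimately show "u *\<^sub>R x + v *\<^sub>R y \<in> apply_bcontfun -` S"
    by simp
qed

lemma continuous_on_apply_bcontfun_product:
  "continuous_on S (apply_bcontfun :: ('a::topological_space \<Rightarrow>\<^sub>C real) \<Rightarrow> 'a \<Rightarrow> real)"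
proof (rule continuous_on_coordinatewise_then_product)
  fix i :: 'a
  have "dist (apply_bcontfun y i) (apply_bcontfun x i) \<le> dist y x" for x y :: "'a \<Rightarrow>\<^sub>C real"
    by (rule dist_bounded)
  then show "continuous_on S (\<lambda>x. apply_bcontfun x i)"
    unfolding continuous_on_iff by (meson le_less_trans)
qed

text \<open>
  The discrete topology on the naturals makes every sequence continuous, and sequences with finitely
  many nonzero terms are bounded.
\<close>

lemma Euclidean_space_subset_range_apply_bcontfun:
  "topspace (Euclidean_space d) \<subseteq> range (apply_bcontfun :: (nat \<Rightarrow>\<^sub>C real) \<Rightarrow> nat \<Rightarrow> real)"
proof
  fix f assume "f \<in> topspace (Euclidean_space d)"
  then have "f i = 0" if "i \<ge> d" for i
    using that by (simp add: topspace_Euclidean_space)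
  then have "range f \<subseteq> insert 0 (f ` {..<d})"
    by (metis image_eqI image_subsetI insert_iff lessThan_iff not_less)
  then have "f \<in> bcontfun"
    by (auto simp: bcontfun_def intro: finite_imp_bounded finite_subset)
  then show "f \<in> range (apply_bcontfun :: (nat \<Rightarrow>\<^sub>C real) \<Rightarrow> nat \<Rightarrow> real)"
    by (metis bcontfunE rangeI)
qed

lemma openin_vimage_apply_bcontfun:
  assumes "openin (Euclidean_space d) S"
  shows "openin (top_of_set (apply_bcontfun -` topspace (Euclidean_space d)))
    (apply_bcontfun -` S :: (nat \<Rightarrow>\<^sub>C real) set)"
proof -
  have "openin (top_of_set (topspace (Euclidean_space d))) S"
    using assms by (simp add: Euclidean_space_def euclidean_product_topology)
  then obtain T where T: "open T" "S = topspace (Euclidean_space d) \<inter> T"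
    unfolding openin_open by blast
  have "open (apply_bcontfun -` T :: (nat \<Rightarrow>\<^sub>C real) set)"
    using T(1) continuous_on_apply_bcontfun_product by (rule open_vimage)
  then show ?thesis
    using T(2) by (auto simp: openin_open vimage_Int)
qed

theorem simplex_collapses_onto_nerve:
  fixes U :: "nat \<Rightarrow> (nat \<Rightarrow> real) set"
  assumes n: "n \<ge> 1"
    and U: "\<And>i. i \<in> {1..n} \<Longrightarrow> convex (U i)" "\<And>i. i \<in> {1..n} \<Longrightarrow> openin (Euclidean_space d) (U i)"
    and union: "convex (\<Union>i\<in>{1..n}. U i)"
  shows "collapses_onto (Pow {1..n}) (nerve n U)"
proof -
  define X where "X = (\<Union>i\<in>{1..n}. U i)"
  define V where "V i = (apply_bcontfun -` U i :: (nat \<Rightarrow>\<^sub>C real) set)" for i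
  define Y where "Y = (apply_bcontfun -` X :: (nat \<Rightarrow>\<^sub>C real) set)"
  have X_sub: "X \<subseteq> topspace (Euclidean_space d)"
    using U(2) openin_subset unfolding X_def by blast
  have V_open: "openin (top_of_set Y) (V i)" if i: "i \<in> {1..n}" for i
  proof (rule openin_subset_trans)
    show "openin (top_of_set (apply_bcontfun -` topspace (Euclidean_space d))) (V i)"
      unfolding V_def using U(2)[OF i] by (rule openin_vimage_apply_bcontfun)
    show "V i \<subseteq> Y" "Y \<subseteq> apply_bcontfun -` topspace (Euclidean_space d)"
      using i X_sub unfolding V_def X_def Y_def by blast+
  qed
  have Y_convex: "convex Y"
    unfolding Y_def X_def using union by (rule convex_vimage_apply_bcontfun)
  have Y_eq: "Y = (\<Union>i\<in>{1..n}. V i)"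
    unfolding Y_def X_def V_def by auto
  have V_convex: "convex (V i)" if "i \<in> {1..n}" for i
    unfolding V_def using U(1)[OF that] by (rule convex_vimage_apply_bcontfun)
  obtain C :: "(nat \<Rightarrow>\<^sub>C real) set" and K where CK: "convex C" "compact C" "C \<subseteq> (\<Union>i\<in>{1..n}. K i)"
    "\<And>i. i \<in> {1..n} \<Longrightarrow> convex (K i)" "\<And>i. i \<in> {1..n} \<Longrightarrow> compact (K i)"
    "trace_nerve {1..n} K C = trace_nerve {1..n} V Y"
    by (rule compact_convex_refinement[OF finite_atLeastAtMost Y_convex Y_eq V_convex V_open]) (assumption | rule that)+
  have "collapses_onto (Pow {1..n}) (trace_nerve {1..n} K C)"
  proof (rule simplex_collapses_onto_trace_nerve)
    show "{1..n} \<noteq> {}"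
      using n by simp
    show "closed (K i)" if "i \<in> {1..n}" for i
      using CK(5)[OF that] by (rule compact_imp_closed)
  qed (use CK in blast)+
  also have "\<dots> = nerve n U"
  proof -
    have "Y \<inter> (\<Inter>i\<in>\<sigma>. V i) \<noteq> {} \<longleftrightarrow> nerve_region n U \<sigma> \<noteq> {}" if "\<sigma> \<subseteq> {1..n}" for \<sigma>
    proof -
      have region: "nerve_region n U \<sigma> = X \<inter> (\<Inter>i\<in>\<sigma>. U i)"
        using that union by (auto simp: nerve_region_def X_def hull_same)
      then have "nerve_region n U \<sigma> \<subseteq> range (apply_bcontfun :: (nat \<Rightarrow>\<^sub>C real) \<Rightarrow> _)"
        using X_sub Euclidean_space_subset_range_apply_bcontfun by blast
      moreover have "Y \<inter> (\<Inter>i\<in>\<sigma>. V i) = apply_bcontfun -` nerve_region n U \<sigma>"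
        unfolding region Y_def V_def by auto
      ultimately show ?thesis by blast
    qed
    then show ?thesis
      unfolding CK(6) by (auto simp: trace_nerve_def nerve_def)
  qed
  finally show ?thesis .
qed

section \<open>The Alexander dual of a convex union representable complex\<close>

theorem theorem6p3:
  fixes n :: nat and \<Delta> :: "nat set set"
  assumes "n \<ge> 1"
    and "abstract_simplicial_complex {1..n} \<Delta>"
    and "vertex_set \<Delta> = {1..n}"
    and "convex_union_representable n \<Delta>"
  shows "collapsible (alexander_dual {1..n} \<Delta>)"
proof -
  obtain d U where "\<And>i. i \<in> {1..n} \<Longrightarrow> convex (U i)"
    "\<And>i. i \<in> {1..n} \<Longrightarrow> openin (Euclidean_space d) (U i)"
    "convex (\<Union>i\<in>{1..n}. U i)" and \<Delta>: "\<Delta> = nerve n U"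
    using assms(4) unfolding convex_union_representable_def d_convex_union_representable_def by blast
  then have "collapses_onto (Pow {1..n}) \<Delta>"
    using simplex_collapses_onto_nerve[OF assms(1)] by blast
  moreover have "abstract_simplicial_complex {1..n} (Pow {1..n})"
    by (auto simp: abstract_simplicial_complex_def)
  ultimately have "collapses_onto (alexander_dual {1..n} \<Delta>) (alexander_dual {1..n} (Pow {1..n}))"
    by (rule alexander_dual_collapses_onto)
  moreover have "alexander_dual {1..n} (Pow {1..n}) = {}"
    by (auto simp: alexander_dual_def)
  ultimately show ?thesis
    by (simp add: collapsible_def)
qed

end
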